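(* Let $(G_N)_{N\ge1}$ be a sequence of 2-regular configuration models $\mathrm{CM}_N(\mathbf 2)$. Then, for all $\beta\ge0$, $B\in\mathbb R$ and for any $\varepsilon>0$, there exists a number $L=L(\varepsilon)>0$ such that $$\widetilde P_N\Big(\Big|\frac{S_N}{N}-\widetilde M\Big|\ge\varepsilon\Big)\le e^{-NL}\qquad\text{for all sufficiently large }N,$$ where $\widetilde M=\widetilde M(\beta,B)=\lim_{N\to\infty}\widetilde P_N(S_N/N)=\dfrac{\sinh(B)}{\sqrt{\sinh^2(B)+e^{-4\beta}}}$ is the annealed magnetization.
   Context: Configuration model: given degrees $(d_i)_{i\in[N]}$ with even sum, attach $d_i$ half-edges to vertex $i\in[N]=\{1,\dots,N\}$ and pair all half-edges uniformly at random; each pair forms an edge, giving a random multigraph (self-loops and multiple edges allowed). $\mathrm{CM}_N(\mathbf 2)$ is the case $d_i=2$ for all $i\in[N]$. Annealed Ising model: let $Q_N$ denote the law of the random multigraph $G_N=([N],E_N)$ and also the corresponding expectation; $E_N$ is counted with multiplicity, and a self-loop at $i$ contributes a term $\sigma_i\sigma_i=1$ once. For $\beta\ge0$, $B\in\mathbb R$ the annealed measure on $\sigma\in\{-1,1\}^N$ is $$\widetilde P_N(\sigma)=\frac{Q_N\big(\exp[\beta\sum_{(i,j)\in E_N}\sigma_i\sigma_j+B\sum_{i\in[N]}\sigma_i]\big)}{Q_N(Z_N(\beta,B))},\qquad Z_N(\beta,B)=\sum_{\sigma\in\{-1,1\}^N}\exp\Big[\beta\sum_{(i,j)\in E_N}\sigma_i\sigma_j+B\sum_{i\in[N]}\sigma_i\Big].$$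 $\widetilde P_N(\cdot)$ also denotes expectation; $S_N=\sum_{i\in[N]}\sigma_i$ is the total spin. *)

theory Defs
  imports "HOL-Probability.Probability"
begin

definition half_edges :: "(nat \<Rightarrow> nat) \<Rightarrow> nat \<Rightarrow> (nat \<times> nat) set" where
  "half_edges d N = (SIGMA i:{1..N}. {..<d i})"

definition pairings :: "'a set \<Rightarrow> 'a set set set" where
  "pairings H = {M. partition_on H M \<and> (\<forall>p\<in>M. card p = 2)}"

text \<open>An edge is the two-element multiset of its endpoints, so that a self-loop at \<open>i\<close> is
  \<open>{#i, i#}\<close>; the outer multiset records the multiplicities of the edges. The vertex set
  \<open>{1..N}\<close> is kept separately.\<close>

type_synonym multigraph_edges = "nat multiset multiset"

definition edges_of_pairing :: "(nat \<times> nat) set set \<Rightarrow> multigraph_edges" where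
  "edges_of_pairing M = image_mset (\<lambda>p. image_mset fst (mset_set p)) (mset_set M)"

text \<open>Only meaningful if \<open>\<Sum>i=1..N. d i\<close> is even: otherwise there are no pairings and
  \<^const>\<open>pmf_of_set\<close> is unspecified.\<close>

definition config_model :: "(nat \<Rightarrow> nat) \<Rightarrow> nat \<Rightarrow> multigraph_edges pmf" where
  "config_model d N = map_pmf edges_of_pairing (pmf_of_set (pairings (half_edges d N)))"

definition spin_configs :: "nat \<Rightarrow> (nat \<Rightarrow> real) set" where
  "spin_configs N = {1..N} \<rightarrow>\<^sub>E {- 1, 1}"

definition total_spin :: "nat \<Rightarrow> (nat \<Rightarrow> real) \<Rightarrow> real" where
  "total_spin N \<sigma> = (\<Sum>i\<in>{1..N}. \<sigma> i)"

text \<open>For an edge \<open>e = {#i, j#}\<close> the inner product is \<open>\<sigma> i * \<sigma> j\<close>.\<close>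

definition ising_weight ::
  "real \<Rightarrow> real \<Rightarrow> nat \<Rightarrow> multigraph_edges \<Rightarrow> (nat \<Rightarrow> real) \<Rightarrow> real" where
  "ising_weight \<beta> B N E \<sigma> =
     exp (\<beta> * (\<Sum>e\<in>#E. \<Prod>i\<in>#e. \<sigma> i) + B * (\<Sum>i\<in>{1..N}. \<sigma> i))"

definition partition_function :: "real \<Rightarrow> real \<Rightarrow> nat \<Rightarrow> multigraph_edges \<Rightarrow> real" where
  "partition_function \<beta> B N E = (\<Sum>\<sigma>\<in>spin_configs N. ising_weight \<beta> B N E \<sigma>)"

definition annealed_mass ::
  "multigraph_edges pmf \<Rightarrow> real \<Rightarrow> real \<Rightarrow> nat \<Rightarrow> (nat \<Rightarrow> real) \<Rightarrow> real" where
  "annealed_mass Q \<beta> B N \<sigma> =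
     measure_pmf.expectation Q (\<lambda>E. ising_weight \<beta> B N E \<sigma>) /
     measure_pmf.expectation Q (\<lambda>E. partition_function \<beta> B N E)"

definition annealed_measure ::
  "multigraph_edges pmf \<Rightarrow> real \<Rightarrow> real \<Rightarrow> nat \<Rightarrow> (nat \<Rightarrow> real) measure" where
  "annealed_measure Q \<beta> B N =
     point_measure (spin_configs N) (\<lambda>\<sigma>. ennreal (annealed_mass Q \<beta> B N \<sigma>))"

abbreviation CM2 :: "nat \<Rightarrow> multigraph_edges pmf" where
  "CM2 N \<equiv> config_model (\<lambda>_. 2) N"

definition annealed_mean_spin :: "real \<Rightarrow> real \<Rightarrow> nat \<Rightarrow> real" where
  "annealed_mean_spin \<beta> B N =
     (\<integral>\<sigma>. total_spin N \<sigma> / real N \<partial>annealed_measure (CM2 N) \<beta> B N)"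

definition annealed_magnetization :: "real \<Rightarrow> real \<Rightarrow> real" where
  "annealed_magnetization \<beta> B = lim (annealed_mean_spin \<beta> B)"


subsection \<open>Well-definedness\<close>

lemma finite_half_edges: "finite (half_edges d N)"
  by (auto simp: half_edges_def)

lemma card_half_edges: "card (half_edges d N) = (\<Sum>i=1..N. d i)"
  by (simp add: half_edges_def)

lemma finite_pairings:
  assumes "finite H"
  shows "finite (pairings H)"
proof (rule finite_subset)
  show "pairings H \<subseteq> Pow (Pow H)"
    by (auto simp: pairings_def partition_on_def)
qed (use assms in simp)

lemma pairings_nonempty:
  assumes "finite H" "even (card H)"
  shows "pairings H \<noteq> {}"
  using assms
proof (induction "card H" arbitrary: H rule: less_induct)
  case less
  show ?case
  proof (cases "H = {}")
    case True
    then have "{} \<in> pairings H" by (simp add: pairings_def partition_on_def)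
    then show ?thesis by blast
  next
    case False
    then have "card H \<noteq> 0" using less.prems by simp
    then have "2 \<le> card H" using less.prems(2) by presburger
    then obtain p where p: "p \<subseteq> H" "card p = 2"
      using obtain_subset_with_card_n by metis
    have fp: "finite p" using p less.prems finite_subset by blast
    have c: "card (H - p) = card H - 2"
      using p fp by (simp add: card_Diff_subset)
    have "pairings (H - p) \<noteq> {}"
      using less.hyps[of "H - p"] c \<open>2 \<le> card H\<close> less.prems by auto
    then obtain M where M: "partition_on (H - p) M" "\<forall>q\<in>M. card q = 2"
      by (auto simp: pairings_def)
    have "partition_on H (insert p M)"
    proof (subst partition_on_insert)
      show "disjnt p (\<Union>M)"
        using M(1) by (auto simp: partition_on_def disjnt_iff)
      show "partition_on (H - p) M \<and> p \<subseteq> H \<and> p \<noteq> {}"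
        using M(1) p by auto
    qed
    with M(2) p(2) have "insert p M \<in> pairings H" by (simp add: pairings_def)
    then show ?thesis by blast
  qed
qed

lemma finite_set_pmf_config_model:
  assumes "even (\<Sum>i=1..N. d i)"
  shows "finite (set_pmf (config_model d N))"
  using pairings_nonempty[OF finite_half_edges[of d N]] assms
  by (simp add: config_model_def card_half_edges finite_pairings finite_half_edges)

lemma finite_spin_configs: "finite (spin_configs N)"
  by (simp add: spin_configs_def finite_PiE)

lemma spin_configs_nonempty: "spin_configs N \<noteq> {}"
  by (simp add: spin_configs_def PiE_eq_empty_iff)

lemma prob_space_annealed_measure:
  assumes "finite (set_pmf Q)"
  shows "prob_space (annealed_measure Q \<beta> B N)"
proof -
  define w where "w \<sigma> = measure_pmf.expectation Q (\<lambda>E. ising_weight \<beta> B N E \<sigma>)" for \<sigma>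
  have int: "integrable (measure_pmf Q) f" for f :: "_ \<Rightarrow> real"
    using assms by (rule integrable_measure_pmf_finite)
  have Z: "measure_pmf.expectation Q (partition_function \<beta> B N) = (\<Sum>\<sigma>\<in>spin_configs N. w \<sigma>)"
    unfolding partition_function_def[abs_def] w_def by (rule Bochner_Integration.integral_sum) (rule int)
  have w: "w \<sigma> > 0" for \<sigma>
  proof -
    obtain E where E: "E \<in> set_pmf Q" using set_pmf_not_empty by fast
    have "w \<sigma> = (\<Sum>E\<in>set_pmf Q. ising_weight \<beta> B N E \<sigma> * pmf Q E)"
      unfolding w_def by (rule integral_measure_pmf_real[OF assms]) simp
    also have "\<dots> > 0"
      by (rule sum_pos[OF assms set_pmf_not_empty]) (simp add: ising_weight_def pmf_positive)
    finally show ?thesis .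
  qed
  have pos: "(\<Sum>\<sigma>\<in>spin_configs N. w \<sigma>) > 0"
    by (rule sum_pos[OF finite_spin_configs spin_configs_nonempty w])
  have mass: "annealed_mass Q \<beta> B N \<sigma> = w \<sigma> / (\<Sum>\<sigma>\<in>spin_configs N. w \<sigma>)" for \<sigma>
    unfolding annealed_mass_def Z by (simp add: w_def)
  have "(\<Sum>\<sigma>\<in>spin_configs N. ennreal (annealed_mass Q \<beta> B N \<sigma>)) =
          ennreal (\<Sum>\<sigma>\<in>spin_configs N. annealed_mass Q \<beta> B N \<sigma>)"
    using w pos by (intro sum_ennreal) (simp add: mass less_imp_le)
  also have "(\<Sum>\<sigma>\<in>spin_configs N. annealed_mass Q \<beta> B N \<sigma>) = 1"
    using pos by (simp add: mass flip: sum_divide_distrib)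
  finally show ?thesis
    unfolding annealed_measure_def
    by (intro prob_spaceI)
       (simp add: space_point_measure emeasure_point_measure_finite finite_spin_configs)
qed

lemma prob_space_annealed_CM2: "prob_space (annealed_measure (CM2 N) \<beta> B N)"
  by (intro prob_space_annealed_measure finite_set_pmf_config_model) simp

end

theory Submission
  imports Defs "HOL-Real_Asymp.Real_Asymp"
begin

text \<open>
  Averaging over the uniform pairing turns the annealed model into the one-dimensional Ising
  transfer matrix. Write the interaction as \<open>exp (\<beta> s t) = u s * u t + v s * v t\<close> for
  \<open>s, t \<in> {-1, 1}\<close>. For a fixed spin configuration the sum over pairings of the Boltzmann weights then
  splits over two-colourings of the half-edges (\<open>sum_pairings_rank_two\<close>). The
  factorization can be chosen such that \<open>u\<close> and \<open>v\<close> are orthogonal for the external field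
  (\<open>diagonalizing_exists\<close>). Because every vertex has exactly two half-edges, summing over its spin
  produces a quadratic expression in \<open>u\<close> and \<open>v\<close>, and orthogonality kills the mixed term. So only
  colourings of whole vertices survive (\<open>annealed_partition_expansion\<close>), and they contribute \<open>\<mu>\<close> or
  \<open>\<nu>\<close> per vertex, the two eigenvalues of the transfer matrix.

  Counting pairings shows that, up to a factor polynomial in \<open>N\<close>, the annealed partition function
  equals \<open>\<lambda>(B)^N (2N - 1)!!\<close>, where \<open>\<lambda>(B)\<close> is the larger eigenvalue (\<open>annealed_partition_bounds\<close>).
  The double factorial is independent of \<open>B\<close>. Since the moment generating function of the total
  spin is the quotient of the partition functions at \<open>B + t\<close> and at \<open>B\<close>, its exponential growth rate
  is \<open>ln \<lambda>(B + t) - ln \<lambda>(B)\<close>. This rate is differentiable at \<open>t = 0\<close> with derivative the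
  stated magnetization (\<open>DERIV_ln_top_eigenvalue\<close>), so the Chernoff bound gives exponential
  concentration (\<open>annealed_concentration\<close>), and concentration of a bounded variable gives the
  convergence of its mean.
\<close>

section \<open>Pairings of a finite set\<close>

lemma pairing_finite:
  assumes "finite H" "M \<in> pairings H"
  shows "finite M"
  using assms finite_elements by (auto simp: pairings_def)

lemma prod_pairing:
  fixes f :: "'a \<Rightarrow> 'b :: comm_monoid_mult"
  assumes "finite H" "M \<in> pairings H"
  shows "(\<Prod>p\<in>M. \<Prod>h\<in>p. f h) = (\<Prod>h\<in>H. f h)"
proof -
  have M: "\<Union>M = H" "disjoint M" "\<forall>p\<in>M. finite p"
    using assms by (auto simp: pairings_def partition_on_def intro: card_ge_0_finite)
  have "(\<Prod>h\<in>\<Union>M. f h) = (\<Prod>p\<in>M. \<Prod>h\<in>p. f h)"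
    using M by (subst prod.Union_disjoint) (auto simp: pairwise_def disjnt_def)
  then show ?thesis using M by simp
qed

lemma pairings_union:
  assumes "S \<subseteq> H" "M1 \<in> pairings S" "M2 \<in> pairings (H - S)"
  shows "M1 \<union> M2 \<in> pairings H" "M1 \<inter> M2 = {}"
proof -
  have 1: "\<Union>M1 = S" "\<Union>M2 = H - S" "disjoint M1" "disjoint M2" "{} \<notin> M1" "{} \<notin> M2"
    using assms by (auto simp: pairings_def partition_on_def)
  have "disjoint (M1 \<union> M2)"
    using 1 by (intro disjoint_union) auto
  with 1 assms show "M1 \<union> M2 \<in> pairings H"
    by (auto simp: pairings_def partition_on_def)
  show "M1 \<inter> M2 = {}"
  proof (rule ccontr)
    assume "M1 \<inter> M2 \<noteq> {}"
    then obtain p where p: "p \<in> M1" "p \<in> M2" by blast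
    with 1 have "p \<subseteq> S" "p \<subseteq> H - S" by auto
    then have "p = {}" by blast
    with p 1 show False by simp
  qed
qed

lemma pairings_split:
  assumes "M \<in> pairings H" "X \<subseteq> M"
  shows "X \<in> pairings (\<Union>X)" "M - X \<in> pairings (H - \<Union>X)" "\<Union>X \<subseteq> H"
proof -
  have 1: "\<Union>M = H" "disjoint M" "{} \<notin> M" "\<forall>p\<in>M. card p = 2"
    using assms by (auto simp: pairings_def partition_on_def)
  show "\<Union>X \<subseteq> H" using 1 assms by auto
  show "X \<in> pairings (\<Union>X)"
    using 1 assms by (auto simp: pairings_def partition_on_def intro: pairwise_subset)
  have "\<Union>(M - X) = H - \<Union>X"
  proof (intro subset_antisym subsetI)
    fix x assume "x \<in> \<Union>(M - X)"
    then obtain p where p: "p \<in> M" "p \<notin> X" "x \<in> p" by blast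
    have "x \<notin> q" if "q \<in> X" for q
    proof -
      have "q \<in> M" "q \<noteq> p" using that assms p by auto
      then have "disjnt q p" using 1 p by (auto simp: pairwise_def)
      with p show ?thesis by (auto simp: disjnt_def)
    qed
    then show "x \<in> H - \<Union>X" using 1 p by blast
  next
    fix x assume "x \<in> H - \<Union>X"
    then show "x \<in> \<Union>(M - X)" using 1 by blast
  qed
  then show "M - X \<in> pairings (H - \<Union>X)"
    using 1 assms by (auto simp: pairings_def partition_on_def intro: pairwise_subset)
qed

text \<open>Expanding the product assigns to every pair of \<open>M\<close> one of two colours. Grouping the terms by the
  set \<open>S\<close> of points in pairs of the first colour decouples the two colours: what remains of the
  pairing is an arbitrary pairing of \<open>S\<close> and an arbitrary pairing of the complement. For independent
  standard Gaussian \<open>X\<close> and \<open>Y\<close>, this is Wick's formula for the expectation of the product of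
  \<open>f h * X + g h * Y\<close> over \<open>h \<in> H\<close>.\<close>

lemma sum_pairings_rank_two:
  fixes f g :: "'a \<Rightarrow> real"
  assumes H: "finite H"
  shows "(\<Sum>M\<in>pairings H. \<Prod>p\<in>M. (\<Prod>h\<in>p. f h) + (\<Prod>h\<in>p. g h)) =
         (\<Sum>S\<in>Pow H. (\<Prod>h\<in>S. f h) * (\<Prod>h\<in>H - S. g h) *
            (real (card (pairings S)) * real (card (pairings (H - S)))))"
proof -
  have fin: "finite (pairings S)" if "S \<subseteq> H" for S
    using finite_pairings finite_subset[OF that H] .
  have "(\<Sum>M\<in>pairings H. \<Prod>p\<in>M. (\<Prod>h\<in>p. f h) + (\<Prod>h\<in>p. g h)) =
        (\<Sum>M\<in>pairings H. \<Sum>X\<in>Pow M. (\<Prod>p\<in>X. \<Prod>h\<in>p. f h) * (\<Prod>p\<in>M - X. \<Prod>h\<in>p. g h))"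
    by (intro sum.cong refl prod_add pairing_finite[OF H])
  also have "\<dots> = (\<Sum>(M, X)\<in>Sigma (pairings H) Pow.
                  (\<Prod>p\<in>X. \<Prod>h\<in>p. f h) * (\<Prod>p\<in>M - X. \<Prod>h\<in>p. g h))"
    using pairing_finite[OF H] by (subst sum.Sigma) (auto simp: fin)
  also have "\<dots> = (\<Sum>(S, M1, M2)\<in>Sigma (Pow H) (\<lambda>S. pairings S \<times> pairings (H - S)).
                  (\<Prod>h\<in>S. f h) * (\<Prod>h\<in>H - S. g h))"
  proof (rule sum.reindex_bij_witness[where j = "\<lambda>(M, X). (\<Union>X, X, M - X)"
             and i = "\<lambda>(S, M1, M2). (M1 \<union> M2, M1)"])
    fix a assume "a \<in> Sigma (pairings H) Pow"
    then obtain M X where a: "a = (M, X)" and MX: "M \<in> pairings H" "X \<subseteq> M" by auto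
    note sp = pairings_split[OF MX]
    show "(case case a of (M, X) \<Rightarrow> (\<Union>X, X, M - X) of (S, M1, M2) \<Rightarrow> (M1 \<union> M2, M1)) = a"
      using a MX by auto
    show "(case a of (M, X) \<Rightarrow> (\<Union>X, X, M - X)) \<in> Sigma (Pow H) (\<lambda>S. pairings S \<times> pairings (H - S))"
      using a sp by auto
    have "finite (\<Union>X)" "finite (H - \<Union>X)" using H sp(3) finite_subset by auto
    then show "(case case a of (M, X) \<Rightarrow> (\<Union>X, X, M - X) of
          (S, M1, M2) \<Rightarrow> (\<Prod>h\<in>S. f h) * (\<Prod>h\<in>H - S. g h)) =
        (case a of (M, X) \<Rightarrow> (\<Prod>p\<in>X. \<Prod>h\<in>p. f h) * (\<Prod>p\<in>M - X. \<Prod>h\<in>p. g h))"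
      using a prod_pairing[OF _ sp(1), of f] prod_pairing[OF _ sp(2), of g] by simp
  next
    fix b assume "b \<in> Sigma (Pow H) (\<lambda>S. pairings S \<times> pairings (H - S))"
    then obtain S M1 M2 where b: "b = (S, M1, M2)" "S \<subseteq> H" "M1 \<in> pairings S" "M2 \<in> pairings (H - S)"
      by auto
    have "\<Union>M1 = S" using b by (auto simp: pairings_def partition_on_def)
    then show "(case case b of (S, M1, M2) \<Rightarrow> (M1 \<union> M2, M1) of (M, X) \<Rightarrow> (\<Union>X, X, M - X)) = b"
      using b pairings_union[OF b(2-4)] by auto
    show "(case b of (S, M1, M2) \<Rightarrow> (M1 \<union> M2, M1)) \<in> Sigma (pairings H) Pow"
      using b pairings_union[OF b(2-4)] by auto
  qed
  also have "\<dots> = (\<Sum>S\<in>Pow H. \<Sum>(M1, M2)\<in>pairings S \<times> pairings (H - S).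
                  (\<Prod>h\<in>S. f h) * (\<Prod>h\<in>H - S. g h))"
    using H fin by (subst sum.Sigma) (auto simp: case_prod_unfold)
  also have "\<dots> = (\<Sum>S\<in>Pow H. (\<Prod>h\<in>S. f h) * (\<Prod>h\<in>H - S. g h) *
            (real (card (pairings S)) * real (card (pairings (H - S)))))"
    by (intro sum.cong refl) (simp add: card_cartesian_product)
  finally show ?thesis .
qed

text \<open>This is the double factorial \<open>(2k - 1)!!\<close>, the \<open>2k\<close>-th moment of a standard Gaussian.\<close>

definition pairing_count :: "nat \<Rightarrow> real" where
  "pairing_count k = fact (2 * k) / (2 ^ k * fact k)"

lemma pairing_count_pos: "pairing_count k > 0"
  by (simp add: pairing_count_def)

lemma pairings_by_partner:
  assumes "finite H" "h \<in> H"
  shows "pairings H = (\<Union>h'\<in>H - {h}. insert {h, h'} ` pairings (H - {h, h'}))"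
proof (intro subset_antisym subsetI)
  fix M assume M: "M \<in> pairings H"
  then have 1: "\<Union>M = H" "\<forall>p\<in>M. card p = 2"
    by (auto simp: pairings_def partition_on_def)
  with assms obtain p where p: "p \<in> M" "h \<in> p" by auto
  with 1 have "card p = 2" by auto
  with p obtain h' where h': "p = {h, h'}" "h' \<noteq> h"
    by (metis card_2_iff doubleton_eq_iff insert_iff singletonD)
  have "h' \<in> H - {h}" using h' p 1 by auto
  moreover have "M - {p} \<in> pairings (H - p)"
    using pairings_split(2)[OF M, of "{p}"] p by simp
  moreover have "M = insert p (M - {p})" using p by auto
  ultimately show "M \<in> (\<Union>h'\<in>H - {h}. insert {h, h'} ` pairings (H - {h, h'}))"
    unfolding h' by blast
next
  fix M assume "M \<in> (\<Union>h'\<in>H - {h}. insert {h, h'} ` pairings (H - {h, h'}))"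
  then obtain h' M' where M': "h' \<in> H" "h' \<noteq> h" "M' \<in> pairings (H - {h, h'})" "M = insert {h, h'} M'"
    by auto
  have "{{h, h'}} \<in> pairings {h, h'}"
    using M' by (auto simp: pairings_def partition_on_space)
  from pairings_union(1)[OF _ this M'(3)] M' assms show "M \<in> pairings H" by simp
qed

text \<open>The recursion \<open>(2k + 1)!! = (2k + 1) (2k - 1)!!\<close>: a fixed point has \<open>2k + 1\<close> possible partners.\<close>

lemma card_pairings:
  assumes "finite H" "card H = 2 * k"
  shows "real (card (pairings H)) = pairing_count k"
  unfolding pairing_count_def using assms
proof (induction k arbitrary: H)
  case 0
  then have "pairings H = {{}}" by (auto simp: pairings_def partition_on_empty)
  then show ?case by simp
next
  case (Suc k)
  then obtain h where h: "h \<in> H" by fastforce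
  have disj: "insert {h, a} ` pairings (H - {h, a}) \<inter> insert {h, b} ` pairings (H - {h, b}) = {}"
    if "a \<in> H - {h}" "b \<in> H - {h}" "a \<noteq> b" for a b
  proof -
    have "{h, a} \<notin> M" if "M \<in> pairings (H - {h, b})" for M
      using that by (auto simp: pairings_def partition_on_def)
    then show ?thesis using that by (auto simp: doubleton_eq_iff insert_eq_iff)
  qed
  have card1: "real (card (insert {h, a} ` pairings (H - {h, a}))) = fact (2 * k) / (2 ^ k * fact k)"
    if "a \<in> H - {h}" for a
  proof -
    have "{h, a} \<notin> M" if "M \<in> pairings (H - {h, a})" for M
      using that by (auto simp: pairings_def partition_on_def)
    then have "inj_on (insert {h, a}) (pairings (H - {h, a}))"
      by (intro inj_onI) (metis insert_ident)
    then have "card (insert {h, a} ` pairings (H - {h, a})) = card (pairings (H - {h, a}))"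
      by (rule card_image)
    moreover have "card (H - {h, a}) = 2 * k"
      using that h Suc.prems by (subst card_Diff_subset) auto
    ultimately show ?thesis using Suc.IH[of "H - {h, a}"] Suc.prems by simp
  qed
  have "card (pairings H) = (\<Sum>a\<in>H - {h}. card (insert {h, a} ` pairings (H - {h, a})))"
    unfolding pairings_by_partner[OF Suc.prems(1) h]
    using Suc.prems disj by (intro card_UN_disjoint) (auto intro!: finite_imageI finite_pairings)
  then have "real (card (pairings H)) = (\<Sum>a\<in>H - {h}. fact (2 * k) / (2 ^ k * fact k))"
    by (simp only: of_nat_sum card1 cong: sum.cong)
  also have "\<dots> = real (2 * k + 1) * (fact (2 * k) / (2 ^ k * fact k))"
    using Suc.prems h by simp
  also have "\<dots> = fact (2 * Suc k) / (2 ^ Suc k * fact (Suc k))"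
  proof -
    have "(fact (2 * Suc k) :: real) = real (2 * k + 2) * (real (2 * k + 1) * fact (2 * k))"
      by (simp add: algebra_simps)
    then show ?thesis by (simp add: divide_simps)
  qed
  finally show ?case .
qed

text \<open>Pairing \<open>k\<close> of \<open>N\<close> vertices and the remaining ones separately, for all choices of the \<open>k\<close>
  vertices together, exceeds the number of all pairings by at most a polynomial factor. In terms of central binomial coefficients
  the quotient of the two sides is
  \<open>(2k choose k) (2l choose l) / (2N choose N)\<close> with \<open>k + l = N\<close> up to the factor \<open>2N\<close>, and
  \<open>(2n choose n)\<close> lies between \<open>4^n / (2n)\<close> and \<open>4^n\<close>.\<close>

lemma pairing_count_product_le:
  assumes "0 < N" "k \<le> N"
  shows "real (N choose k) * (pairing_count k * pairing_count (N - k)) \<le> 2 * real N * pairing_count N"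
proof -
  define l where "l = N - k"
  have N: "N = k + l" using assms l_def by simp
  have pc: "pairing_count n = fact n * real ((2 * n) choose n) / 2 ^ n" for n
  proof -
    have "real ((2 * n) choose n) = fact (2 * n) / (fact n * fact n)"
      by (subst binomial_fact) auto
    then show ?thesis by (simp add: pairing_count_def)
  qed
  have "real ((2 * k) choose k) * real ((2 * l) choose l) \<le> 2 ^ (2 * k) * 2 ^ (2 * l)"
  proof (rule mult_mono)
    have "real ((2 * m) choose m) \<le> 2 ^ (2 * m)" for m
      using binomial_le_pow2[of "2 * m" m] by (metis of_nat_le_iff of_nat_numeral of_nat_power)
    then show "real ((2 * k) choose k) \<le> 2 ^ (2 * k)" "real ((2 * l) choose l) \<le> 2 ^ (2 * l)"
      by auto
  qed auto
  also have "\<dots> = 4 ^ N" by (simp add: N power_mult power_add)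
  also have "\<dots> \<le> 2 * real N * real ((2 * N) choose N)"
    using central_binomial_lower_bound[of N] assms by (simp add: field_simps)
  finally have le: "real ((2 * k) choose k) * real ((2 * l) choose l) \<le> 2 * real N * real ((2 * N) choose N)" .
  have c: "real (N choose k) = fact N / (fact k * fact l)"
    using assms by (subst binomial_fact) (auto simp: l_def)
  have "real (N choose k) * (pairing_count k * pairing_count l)
      = fact N / 2 ^ N * (real ((2 * k) choose k) * real ((2 * l) choose l))"
    unfolding c pc by (simp add: N power_add)
  also have "\<dots> \<le> fact N / 2 ^ N * (2 * real N * real ((2 * N) choose N))"
    by (intro mult_left_mono le) auto
  finally show ?thesis by (simp add: pc l_def mult_ac)
qed

section \<open>Annealed weights as sums over pairings\<close>

text \<open>Up to normalisation by the number of pairings, these are the annealed weight of one spin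
  configuration (without its external field factor) and the annealed partition function; the
  normalisation cancels in the annealed measure.\<close>

definition pairing_weight :: "real \<Rightarrow> nat \<Rightarrow> (nat \<Rightarrow> real) \<Rightarrow> real" where
  "pairing_weight \<beta> N \<sigma> =
     (\<Sum>M\<in>pairings (half_edges (\<lambda>_. 2) N). \<Prod>p\<in>M. exp (\<beta> * (\<Prod>h\<in>p. \<sigma> (fst h))))"

definition annealed_partition :: "real \<Rightarrow> real \<Rightarrow> nat \<Rightarrow> real" where
  "annealed_partition \<beta> B N =
     (\<Sum>\<sigma>\<in>spin_configs N. exp (B * total_spin N \<sigma>) * pairing_weight \<beta> N \<sigma>)"

lemma expectation_ising_weight_CM2:
  "measure_pmf.expectation (CM2 N) (\<lambda>E. ising_weight \<beta> B N E \<sigma>) =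
     exp (B * total_spin N \<sigma>) * pairing_weight \<beta> N \<sigma> / real (card (pairings (half_edges (\<lambda>_. 2) N)))"
proof -
  let ?H = "half_edges (\<lambda>_. 2) N"
  have ne: "pairings ?H \<noteq> {}" "finite (pairings ?H)"
    by (simp_all add: pairings_nonempty finite_pairings finite_half_edges card_half_edges)
  have w: "ising_weight \<beta> B N (edges_of_pairing M) \<sigma> =
      exp (B * total_spin N \<sigma>) * (\<Prod>p\<in>M. exp (\<beta> * (\<Prod>h\<in>p. \<sigma> (fst h))))"
    if "M \<in> pairings ?H" for M
  proof -
    have "finite M" using that pairing_finite finite_half_edges by blast
    moreover have "(\<Sum>e\<in>#edges_of_pairing M. \<Prod>i\<in>#e. \<sigma> i) = (\<Sum>p\<in>M. \<Prod>h\<in>p. \<sigma> (fst h))"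
      by (simp add: edges_of_pairing_def prod_unfold_prod_mset sum_unfold_sum_mset
            image_mset.compositionality o_def)
    ultimately show ?thesis
      by (simp add: ising_weight_def total_spin_def exp_add sum_distrib_left exp_sum mult.commute)
  qed
  show ?thesis
    using ne unfolding config_model_def pairing_weight_def
    by (simp add: integral_pmf_of_set w sum_distrib_left)
qed

lemma expectation_partition_function_CM2:
  "measure_pmf.expectation (CM2 N) (partition_function \<beta> B N) =
     annealed_partition \<beta> B N / real (card (pairings (half_edges (\<lambda>_. 2) N)))"
proof -
  have "finite (set_pmf (CM2 N))" by (intro finite_set_pmf_config_model) simp
  then have "measure_pmf.expectation (CM2 N) (partition_function \<beta> B N) =
      (\<Sum>\<sigma>\<in>spin_configs N. measure_pmf.expectation (CM2 N) (\<lambda>E. ising_weight \<beta> B N E \<sigma>))"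
    unfolding partition_function_def[abs_def]
    by (intro Bochner_Integration.integral_sum integrable_measure_pmf_finite)
  then show ?thesis
    by (simp add: expectation_ising_weight_CM2 annealed_partition_def sum_divide_distrib)
qed

lemma annealed_mass_CM2:
  "annealed_mass (CM2 N) \<beta> B N \<sigma> =
     exp (B * total_spin N \<sigma>) * pairing_weight \<beta> N \<sigma> / annealed_partition \<beta> B N"
proof -
  have "card (pairings (half_edges (\<lambda>_. 2) N)) \<noteq> 0"
    by (simp add: pairings_nonempty finite_pairings finite_half_edges card_half_edges)
  then show ?thesis
    unfolding annealed_mass_def expectation_ising_weight_CM2 expectation_partition_function_CM2
    by simp
qed

lemma pairing_weight_pos: "pairing_weight \<beta> N \<sigma> > 0"
  unfolding pairing_weight_def
  by (intro sum_pos prod_pos)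
     (simp_all add: pairings_nonempty finite_pairings finite_half_edges card_half_edges)

lemma annealed_partition_pos: "annealed_partition \<beta> B N > 0"
  unfolding annealed_partition_def
  by (intro sum_pos finite_spin_configs spin_configs_nonempty mult_pos_pos pairing_weight_pos) simp

text \<open>The two half-edges of a vertex carry the same spin, so a sum of products over half-edges
  factorizes over vertices rather than over half-edges.\<close>

lemma sum_spins_factorize:
  fixes f :: "nat \<Rightarrow> nat \<Rightarrow> real \<Rightarrow> real"
  shows "(\<Sum>\<sigma>\<in>spin_configs N. exp (B * total_spin N \<sigma>) *
            (\<Prod>h\<in>half_edges (\<lambda>_. 2) N. f (fst h) (snd h) (\<sigma> (fst h)))) =
         (\<Prod>i\<in>{1..N}. \<Sum>s\<in>{-1, 1}. exp (B * s) * (f i 0 s * f i 1 s))"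
proof -
  have "(\<Prod>i\<in>{1..N}. \<Sum>s\<in>{-1, 1}. exp (B * s) * (f i 0 s * f i 1 s)) =
      (\<Sum>\<sigma>\<in>spin_configs N. \<Prod>i\<in>{1..N}. exp (B * \<sigma> i) * (f i 0 (\<sigma> i) * f i 1 (\<sigma> i)))"
    unfolding spin_configs_def by (rule prod_sum_PiE) auto
  also have "\<dots> = (\<Sum>\<sigma>\<in>spin_configs N. exp (B * total_spin N \<sigma>) *
            (\<Prod>h\<in>half_edges (\<lambda>_. 2) N. f (fst h) (snd h) (\<sigma> (fst h))))"
  proof (rule sum.cong[OF refl])
    fix \<sigma>
    have "(\<Prod>h\<in>half_edges (\<lambda>_. 2) N. f (fst h) (snd h) (\<sigma> (fst h))) =
        (\<Prod>i\<in>{1..N}. \<Prod>r<2. f i r (\<sigma> i))"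
      unfolding half_edges_def by (subst prod.Sigma) (auto simp: case_prod_unfold)
    then show "(\<Prod>i\<in>{1..N}. exp (B * \<sigma> i) * (f i 0 (\<sigma> i) * f i 1 (\<sigma> i))) =
        exp (B * total_spin N \<sigma>) * (\<Prod>h\<in>half_edges (\<lambda>_. 2) N. f (fst h) (snd h) (\<sigma> (fst h)))"
      by (simp add: total_spin_def sum_distrib_left exp_sum prod.distrib numeral_2_eq_2)
  qed
  finally show ?thesis by simp
qed

section \<open>Diagonalization of the annealed partition function\<close>

text \<open>The bilinear form on functions of one spin that collects the two half-edges of a vertex together
  with the external field.\<close>

definition field_form :: "real \<Rightarrow> (real \<Rightarrow> real) \<Rightarrow> (real \<Rightarrow> real) \<Rightarrow> real" where
  "field_form B u v = (\<Sum>s\<in>{-1, 1}. exp (B * s) * (u s * v s))"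

text \<open>For \<open>\<beta> \<ge> 0\<close> the interaction \<open>exp (\<beta> s t)\<close> is a positive semidefinite kernel of rank at most two on
  \<open>{-1, 1}\<close>. The functions \<open>u\<close> and \<open>v\<close> are required both to factor this kernel and to be
  orthogonal for the form of the external field; they are then rescaled eigenvectors
  of the transfer matrix of the one-dimensional Ising model, with eigenvalues
  \<open>field_form B u u\<close> and \<open>field_form B v v\<close>.\<close>

definition diagonalizing :: "real \<Rightarrow> real \<Rightarrow> (real \<Rightarrow> real) \<Rightarrow> (real \<Rightarrow> real) \<Rightarrow> bool" where
  "diagonalizing \<beta> B u v \<longleftrightarrow>
     (\<forall>s\<in>{-1, 1}. \<forall>t\<in>{-1, 1}. exp (\<beta> * (s * t)) = u s * u t + v s * v t) \<and> field_form B u v = 0"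

text \<open>A vertex whose two half-edges have different colours contributes \<open>field_form B u v = 0\<close>. Hence
  the colouring of half-edges must come from a colouring of vertices.\<close>

lemma sum_spins_colored:
  fixes u v :: "real \<Rightarrow> real"
  assumes orth: "field_form B u v = 0"
  defines "\<mu> \<equiv> field_form B u u" and "\<nu> \<equiv> field_form B v v"
  assumes S: "S \<subseteq> half_edges (\<lambda>_. 2) N"
  shows "(\<Sum>\<sigma>\<in>spin_configs N. exp (B * total_spin N \<sigma>) *
           ((\<Prod>h\<in>S. u (\<sigma> (fst h))) * (\<Prod>h\<in>half_edges (\<lambda>_. 2) N - S. v (\<sigma> (fst h))))) =
         (\<Prod>i\<in>{1..N}. if (i, 0) \<in> S \<and> (i, 1) \<in> S then \<mu>
                       else if (i, 0) \<notin> S \<and> (i, 1) \<notin> S then \<nu> else 0)"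
proof -
  let ?H = "half_edges (\<lambda>_. 2) N"
  define f where "f i r s = (if (i, r) \<in> S then u s else v s)" for i r :: nat and s
  have "(\<Prod>h\<in>S. u (\<sigma> (fst h))) * (\<Prod>h\<in>?H - S. v (\<sigma> (fst h))) =
        (\<Prod>h\<in>?H. f (fst h) (snd h) (\<sigma> (fst h)))" for \<sigma> :: "nat \<Rightarrow> real"
    using S prod.subset_diff[OF S finite_half_edges, of "\<lambda>h. f (fst h) (snd h) (\<sigma> (fst h))"]
    by (simp add: f_def mult.commute)
  then have "(\<Sum>\<sigma>\<in>spin_configs N. exp (B * total_spin N \<sigma>) *
           ((\<Prod>h\<in>S. u (\<sigma> (fst h))) * (\<Prod>h\<in>?H - S. v (\<sigma> (fst h))))) =
      (\<Prod>i\<in>{1..N}. \<Sum>s\<in>{-1, 1}. exp (B * s) * (f i 0 s * f i 1 s))"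
    by (simp only: sum_spins_factorize)
  also have "\<dots> = (\<Prod>i\<in>{1..N}. if (i, 0) \<in> S \<and> (i, 1) \<in> S then \<mu>
                       else if (i, 0) \<notin> S \<and> (i, 1) \<notin> S then \<nu> else 0)"
    using orth by (intro prod.cong refl) (simp add: f_def \<mu>_def \<nu>_def field_form_def mult.commute)
  finally show ?thesis .
qed

text \<open>Each pair of half-edges is given the colour \<open>u\<close> or \<open>v\<close> according to the factorization of the
  kernel; summing over the spins first leaves only colourings by a set \<open>T\<close> of vertices. This is
  the \<open>N\<close>-th moment of \<open>\<mu> X\<^sup>2 + \<nu> Y\<^sup>2\<close> for independent standard Gaussian \<open>X\<close> and \<open>Y\<close>.\<close>

lemma annealed_partition_expansion:
  fixes u v :: "real \<Rightarrow> real"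
  assumes uv: "diagonalizing \<beta> B u v"
  defines "\<mu> \<equiv> field_form B u u" and "\<nu> \<equiv> field_form B v v"
  shows "annealed_partition \<beta> B N =
           (\<Sum>T\<in>Pow {1..N}. \<mu> ^ card T * \<nu> ^ (N - card T) *
              (pairing_count (card T) * pairing_count (N - card T)))"
proof -
  have kernel: "exp (\<beta> * (s * t)) = u s * u t + v s * v t" if "s \<in> {-1, 1}" "t \<in> {-1, 1}" for s t
    using uv that unfolding diagonalizing_def by blast
  have orth: "field_form B u v = 0" using uv unfolding diagonalizing_def by blast
  let ?H = "half_edges (\<lambda>_. 2) N"
  define c where "c S = real (card (pairings S)) * real (card (pairings (?H - S)))" for S
  define w where "w S = (\<Prod>i\<in>{1..N}. if (i, 0) \<in> S \<and> (i, 1) \<in> S then \<mu>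
                       else if (i, 0) \<notin> S \<and> (i, 1) \<notin> S then \<nu> else 0)" for S :: "(nat \<times> nat) set"
  have pw: "pairing_weight \<beta> N \<sigma> =
      (\<Sum>S\<in>Pow ?H. (\<Prod>h\<in>S. u (\<sigma> (fst h))) * (\<Prod>h\<in>?H - S. v (\<sigma> (fst h))) * c S)"
    if \<sigma>: "\<sigma> \<in> spin_configs N" for \<sigma>
  proof -
    have "exp (\<beta> * (\<Prod>h\<in>p. \<sigma> (fst h))) = (\<Prod>h\<in>p. u (\<sigma> (fst h))) + (\<Prod>h\<in>p. v (\<sigma> (fst h)))"
      if M: "M \<in> pairings ?H" "p \<in> M" for M p
    proof -
      obtain x y where xy: "p = {x, y}" "x \<noteq> y"
        using M by (auto simp: pairings_def card_2_iff)
      moreover have "p \<subseteq> ?H" using M by (auto simp: pairings_def partition_on_def)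
      ultimately have "\<sigma> (fst x) \<in> {-1, 1}" "\<sigma> (fst y) \<in> {-1, 1}"
        using \<sigma> unfolding spin_configs_def half_edges_def by (auto simp: PiE_iff)
      from kernel[OF this] xy show ?thesis by simp
    qed
    then show ?thesis
      unfolding pairing_weight_def c_def sum_pairings_rank_two[OF finite_half_edges, symmetric]
      by simp
  qed
  have "annealed_partition \<beta> B N = (\<Sum>\<sigma>\<in>spin_configs N. \<Sum>S\<in>Pow ?H. exp (B * total_spin N \<sigma>) *
           ((\<Prod>h\<in>S. u (\<sigma> (fst h))) * (\<Prod>h\<in>?H - S. v (\<sigma> (fst h)))) * c S)"
    by (simp add: annealed_partition_def pw sum_distrib_left mult_ac cong: sum.cong)
  also have "\<dots> = (\<Sum>S\<in>Pow ?H. w S * c S)"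
  proof (subst sum.swap, rule sum.cong[OF refl])
    fix S assume "S \<in> Pow ?H"
    then have "(\<Sum>\<sigma>\<in>spin_configs N. exp (B * total_spin N \<sigma>) *
           ((\<Prod>h\<in>S. u (\<sigma> (fst h))) * (\<Prod>h\<in>?H - S. v (\<sigma> (fst h))))) = w S"
      unfolding w_def \<mu>_def \<nu>_def by (intro sum_spins_colored orth) simp
    then show "(\<Sum>\<sigma>\<in>spin_configs N. exp (B * total_spin N \<sigma>) *
           ((\<Prod>h\<in>S. u (\<sigma> (fst h))) * (\<Prod>h\<in>?H - S. v (\<sigma> (fst h)))) * c S) = w S * c S"
      by (simp flip: sum_distrib_right)
  qed
  also have "\<dots> = (\<Sum>S\<in>(\<lambda>T. T \<times> {..<2}) ` Pow {1..N}. w S * c S)"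
  proof (rule sum.mono_neutral_right)
    show "finite (Pow ?H)" by (simp add: finite_half_edges)
    show "(\<lambda>T. T \<times> {..<2}) ` Pow {1..N} \<subseteq> Pow ?H" by (auto simp: half_edges_def)
    show "\<forall>S\<in>Pow ?H - (\<lambda>T. T \<times> {..<2}) ` Pow {1..N}. w S * c S = 0"
    proof
      fix S assume S: "S \<in> Pow ?H - (\<lambda>T. T \<times> {..<2}) ` Pow {1..N}"
      \<comment> \<open>A set of half-edges that is not a union of vertices splits some vertex \<open>i\<close>, which has weight \<open>0\<close>.\<close>
      have "\<exists>i\<in>{1..N}. \<not> ((i, 0) \<in> S \<longleftrightarrow> (i, 1) \<in> S)"
      proof (rule ccontr)
        assume "\<not> ?thesis"
        then have iff: "(i, 0) \<in> S \<longleftrightarrow> (i, 1) \<in> S" if "i \<in> {1..N}" for i using that by blast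
        have SH: "i \<in> {1..N} \<and> (r = 0 \<or> r = 1)" if "(i, r) \<in> S" for i r
        proof -
          have "(i, r) \<in> ?H" using that S by blast
          then show ?thesis by (auto simp: half_edges_def)
        qed
        have "S = fst ` S \<times> {..<2}"
        proof (intro subset_antisym subsetI)
          fix x :: "nat \<times> nat" assume x: "x \<in> S"
          then have "snd x < 2" using SH[of "fst x" "snd x"] by auto
          with x show "x \<in> fst ` S \<times> {..<2}" by (simp add: mem_Times_iff)
        next
          fix x :: "nat \<times> nat" assume "x \<in> fst ` S \<times> {..<2}"
          then obtain r' where x: "snd x < 2" "(fst x, r') \<in> S" by (auto simp: mem_Times_iff)
          from iff[of "fst x"] SH[OF x(2)] x have "(fst x, 0) \<in> S" "(fst x, 1) \<in> S" by auto
          moreover have "snd x = 0 \<or> snd x = 1" using x by auto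
          ultimately show "x \<in> S" by (metis prod.collapse)
        qed
        moreover have "fst ` S \<in> Pow {1..N}" using SH by force
        ultimately show False using S by blast
      qed
      then have "w S = 0" unfolding w_def by (subst prod_zero_iff) auto
      then show "w S * c S = 0" by simp
    qed
  qed
  also have "\<dots> = (\<Sum>T\<in>Pow {1..N}. w (T \<times> {..<2}) * c (T \<times> {..<2}))"
    by (subst sum.reindex) (auto simp: inj_on_def Times_eq_cancel2[of "0 :: nat"])
  also have "\<dots> = (\<Sum>T\<in>Pow {1..N}. \<mu> ^ card T * \<nu> ^ (N - card T) *
              (pairing_count (card T) * pairing_count (N - card T)))"
  proof (rule sum.cong[OF refl])
    fix T assume "T \<in> Pow {1..N}"
    then have T: "T \<subseteq> {1..N}" by simp
    then have fT: "finite T" using finite_subset by blast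
    have cT: "card ({1..N} - T) = N - card T" using T fT by (simp add: card_Diff_subset)
    have "w (T \<times> {..<2}) = (\<Prod>i\<in>{1..N}. if i \<in> T then \<mu> else \<nu>)"
      unfolding w_def by (intro prod.cong) auto
    also have "\<dots> = (\<Prod>i\<in>{1..N} - T. \<nu>) * (\<Prod>i\<in>T. \<mu>)"
      by (subst prod.subset_diff[OF T]) auto
    finally have w: "w (T \<times> {..<2}) = \<mu> ^ card T * \<nu> ^ (N - card T)"
      by (simp only: prod_constant cT mult.commute)
    have "?H - T \<times> {..<2} = ({1..N} - T) \<times> {..<2}" by (auto simp: half_edges_def)
    then have "c (T \<times> {..<2}) = pairing_count (card T) * pairing_count (N - card T)"
      unfolding c_def using fT
      by (simp only: card_pairings[of "T \<times> {..<2}" "card T"]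
          card_pairings[of "({1..N} - T) \<times> {..<2}" "N - card T"]
          finite_cartesian_product finite_Diff finite_lessThan finite_atLeastAtMost
          card_cartesian_product card_lessThan cT mult.commute)
    with w show "w (T \<times> {..<2}) * c (T \<times> {..<2}) = \<mu> ^ card T * \<nu> ^ (N - card T) *
              (pairing_count (card T) * pairing_count (N - card T))" by simp
  qed
  finally show ?thesis .
qed

text \<open>The lower bound keeps only the terms where all vertices have the same colour; the upper bound
  estimates each of the \<open>N + 1\<close> colour counts separately.\<close>

lemma annealed_partition_bounds_max:
  fixes u v :: "real \<Rightarrow> real"
  assumes uv: "diagonalizing \<beta> B u v"
  defines "\<mu> \<equiv> field_form B u u" and "\<nu> \<equiv> field_form B v v"
  assumes N: "N > 0"
  shows "max \<mu> \<nu> ^ N * pairing_count N \<le> annealed_partition \<beta> B N"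
    and "annealed_partition \<beta> B N \<le> 2 * real N * (real N + 1) * (max \<mu> \<nu> ^ N * pairing_count N)"
proof -
  have nonneg: "\<mu> \<ge> 0" "\<nu> \<ge> 0" unfolding \<mu>_def \<nu>_def field_form_def by auto
  define a where "a T = \<mu> ^ card T * \<nu> ^ (N - card T) *
              (pairing_count (card T) * pairing_count (N - card T))" for T :: "nat set"
  have exp: "annealed_partition \<beta> B N = (\<Sum>T\<in>Pow {1..N}. a T)"
    unfolding a_def \<mu>_def \<nu>_def by (rule annealed_partition_expansion[OF uv])
  have a0: "a T \<ge> 0" for T
    unfolding a_def using nonneg pairing_count_pos by (intro mult_nonneg_nonneg) (auto simp: less_imp_le)
  have "a {1..N} \<le> annealed_partition \<beta> B N" "a {} \<le> annealed_partition \<beta> B N"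
    unfolding exp by (intro member_le_sum a0; simp)+
  then show "max \<mu> \<nu> ^ N * pairing_count N \<le> annealed_partition \<beta> B N"
    by (auto simp: a_def max_def pairing_count_def[of 0])
  define x where "x = max \<mu> \<nu>"
  have x0: "x \<ge> 0" using nonneg by (simp add: x_def)
  have "annealed_partition \<beta> B N \<le> (\<Sum>T\<in>Pow {1..N}. x ^ N * (pairing_count (card T) * pairing_count (N - card T)))"
    unfolding exp
  proof (rule sum_mono)
    fix T assume "T \<in> Pow {1..N}"
    then have "card T \<le> card {1..N}" by (intro card_mono) auto
    then have le: "card T \<le> N" by simp
    have "\<mu> ^ card T * \<nu> ^ (N - card T) \<le> x ^ card T * x ^ (N - card T)"
      using nonneg by (intro mult_mono power_mono) (auto simp: x_def)
    also have "\<dots> = x ^ N" using le by (simp flip: power_add)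
    finally show "a T \<le> x ^ N * (pairing_count (card T) * pairing_count (N - card T))"
      unfolding a_def using pairing_count_pos
      by (intro mult_right_mono) (auto simp: less_imp_le)
  qed
  also have "\<dots> = x ^ N * (\<Sum>k\<le>N. \<Sum>T | T \<in> Pow {1..N} \<and> card T = k. pairing_count (card T) * pairing_count (N - card T))"
    by (subst sum.group) (auto simp: sum_distrib_left intro: card_mono[of "{1..N}", simplified])
  also have "\<dots> = x ^ N * (\<Sum>k\<le>N. real (N choose k) * (pairing_count k * pairing_count (N - k)))"
    by (auto intro!: sum.cong simp: n_subsets)
  also have "\<dots> \<le> x ^ N * (\<Sum>k\<le>N. 2 * real N * pairing_count N)"
    using N x0 by (intro mult_left_mono sum_mono pairing_count_product_le) auto
  finally show "annealed_partition \<beta> B N \<le> 2 * real N * (real N + 1) * (max \<mu> \<nu> ^ N * pairing_count N)"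
    by (simp add: x_def algebra_simps)
qed

text \<open>The pair \<open>sqrt (cosh \<beta>)\<close>, \<open>s * sqrt (sinh \<beta>)\<close> factors the kernel since
  \<open>exp (\<beta> s t) = cosh \<beta> + s t sinh \<beta>\<close>; here \<open>\<beta> \<ge> 0\<close> is used. Rotating the pair preserves the
  factorization, and a suitable angle \<open>\<phi> / 2\<close> makes it orthogonal.\<close>

lemma diagonalizing_exists:
  fixes \<beta> B :: real
  assumes "\<beta> \<ge> 0"
  obtains u v where "diagonalizing \<beta> B u v"
proof -
  define p q where "p = sqrt (cosh \<beta>)" and "q = sqrt (sinh \<beta>)"
  have pq: "p * p = cosh \<beta>" "q * q = sinh \<beta>" using assms by (simp_all add: p_def q_def)
  define a where "a = (q * q - p * p) * cosh B"
  define c where "c = 2 * (p * q) * sinh B"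
  \<comment> \<open>Rotating the pair by \<open>\<phi> / 2\<close> turns the value \<open>c\<close> of the form into \<open>a sin \<phi> + c cos \<phi>\<close>.\<close>
  obtain \<phi> where \<phi>: "a * sin \<phi> + c * cos \<phi> = 0"
  proof (cases "a = 0")
    case True
    then show ?thesis using that[of "pi / 2"] by simp
  next
    case False
    have "cos (arctan (- c / a)) \<noteq> 0" by (rule cos_arctan_not_zero)
    then have "sin (arctan (- c / a)) = (- c / a) * cos (arctan (- c / a))"
      using tan_arctan[of "- c / a"] by (simp add: tan_def field_simps)
    then show ?thesis using False that[of "arctan (- c / a)"] by (simp add: field_simps)
  qed
  define x y where "x = cos (\<phi> / 2)" and "y = sin (\<phi> / 2)"
  have xy: "x * x + y * y = 1" "sin \<phi> = 2 * (y * x)" "cos \<phi> = x * x - y * y"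
    using sin_double[of "\<phi> / 2"] cos_double[of "\<phi> / 2"] sin_cos_squared_add3[of "\<phi> / 2"]
    by (simp_all add: x_def y_def power2_eq_square)
  define u v where "u s = x * p + y * q * s" and "v s = - y * p + x * q * s" for s
  have K: "u s * u t + v s * v t = cosh \<beta> + s * t * sinh \<beta>" for s t
  proof -
    have "u s * u t + v s * v t = (x * x + y * y) * (p * p) + (x * x + y * y) * (s * t * (q * q))"
      by (simp add: u_def v_def algebra_simps)
    then show ?thesis by (simp add: xy pq)
  qed
  have e: "exp \<beta> = cosh \<beta> + sinh \<beta>" "exp (- \<beta>) = cosh \<beta> - sinh \<beta>"
    by (simp_all add: cosh_plus_sinh cosh_minus_sinh)
  have "exp (\<beta> * (s * t)) = u s * u t + v s * v t" if "s \<in> {-1, 1}" "t \<in> {-1, 1}" for s t :: real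
    using that by (auto simp: K e)
  moreover have "field_form B u v = 0"
  proof -
    have eB: "exp B = cosh B + sinh B" "exp (- B) = cosh B - sinh B"
      by (simp_all add: cosh_plus_sinh cosh_minus_sinh)
    have "field_form B u v = a * (2 * (y * x)) + c * (x * x - y * y)"
      by (simp add: field_form_def eB u_def v_def a_def c_def algebra_simps)
    then show ?thesis using \<phi> by (simp add: xy)
  qed
  ultimately show ?thesis by (intro that) (auto simp: diagonalizing_def)
qed

text \<open>The larger eigenvalue of the transfer matrix, whose trace is \<open>2 exp \<beta> cosh B\<close> and whose
  determinant is \<open>exp (2\<beta>) - exp (-2\<beta>)\<close>.\<close>

definition top_eigenvalue :: "real \<Rightarrow> real \<Rightarrow> real" where
  "top_eigenvalue \<beta> B = exp \<beta> * cosh B + sqrt ((exp \<beta> * sinh B)\<^sup>2 + exp (- 2 * \<beta>))"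

text \<open>The sum and the product of \<open>\<mu>\<close> and \<open>\<nu>\<close> are the trace and the determinant of the transfer matrix; the
  product is obtained from Lagrange's identity, in which one square vanishes by orthogonality.\<close>

lemma max_eq_top_eigenvalue:
  fixes u v :: "real \<Rightarrow> real"
  assumes uv: "diagonalizing \<beta> B u v"
  defines "\<mu> \<equiv> field_form B u u" and "\<nu> \<equiv> field_form B v v"
  shows "max \<mu> \<nu> = top_eigenvalue \<beta> B"
proof -
  have kernel: "exp (\<beta> * (s * t)) = u s * u t + v s * v t" if "s \<in> {-1, 1}" "t \<in> {-1, 1}" for s t
    using uv that unfolding diagonalizing_def by blast
  have orth: "field_form B u v = 0" using uv unfolding diagonalizing_def by blast
  have k: "u 1 * u 1 + v 1 * v 1 = exp \<beta>" "u (-1) * u (-1) + v (-1) * v (-1) = exp \<beta>"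
     "u 1 * u (-1) + v 1 * v (-1) = exp (-\<beta>)"
    using kernel[of 1 1] kernel[of "-1" "-1"] kernel[of 1 "-1"] by auto
  have e1: "exp B * exp (- B) = (1 :: real)" by (simp flip: exp_add)
  have tr: "\<mu> + \<nu> = 2 * (exp \<beta> * cosh B)"
  proof -
    have "\<mu> + \<nu> = exp B * (u 1 * u 1 + v 1 * v 1) + exp (- B) * (u (-1) * u (-1) + v (-1) * v (-1))"
      by (simp add: \<mu>_def \<nu>_def field_form_def algebra_simps)
    then show ?thesis by (simp add: k cosh_def algebra_simps)
  qed
  have det: "\<mu> * \<nu> = exp \<beta> * exp \<beta> - exp (-\<beta>) * exp (-\<beta>)"
  proof -
    have "\<mu> * \<nu> = (exp B * (u 1 * v 1) + exp (- B) * (u (-1) * v (-1)))\<^sup>2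
        + exp B * exp (- B) * (u 1 * v (-1) - u (-1) * v 1)\<^sup>2"
      by (simp add: \<mu>_def \<nu>_def field_form_def power2_eq_square algebra_simps)
    also have "exp B * (u 1 * v 1) + exp (- B) * (u (-1) * v (-1)) = 0"
      using orth by (simp add: field_form_def)
    also have "(u 1 * v (-1) - u (-1) * v 1)\<^sup>2 = (u 1 * u 1 + v 1 * v 1) * (u (-1) * u (-1) + v (-1) * v (-1))
        - (u 1 * u (-1) + v 1 * v (-1)) * (u 1 * u (-1) + v 1 * v (-1))"
      by (simp add: power2_eq_square algebra_simps)
    finally show ?thesis by (simp add: k e1)
  qed
  have "((\<mu> - \<nu>) / 2)\<^sup>2 = ((\<mu> + \<nu>) / 2)\<^sup>2 - \<mu> * \<nu>"
    by (simp add: power2_eq_square field_simps)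
  also have "\<dots> = (exp \<beta> * cosh B)\<^sup>2 - exp \<beta> * exp \<beta> + exp (-\<beta>) * exp (-\<beta>)"
    by (simp add: tr det)
  also have "\<dots> = (exp \<beta> * sinh B)\<^sup>2 + exp (- 2 * \<beta>)"
  proof -
    have "(exp \<beta> * cosh B)\<^sup>2 = (exp \<beta> * sinh B)\<^sup>2 + exp \<beta> * exp \<beta>"
      unfolding power_mult_distrib cosh_square_eq by (simp add: power2_eq_square algebra_simps)
    then show ?thesis by (simp flip: exp_add)
  qed
  finally have "sqrt ((exp \<beta> * sinh B)\<^sup>2 + exp (- 2 * \<beta>)) = \<bar>\<mu> - \<nu>\<bar> / 2"
    by (metis real_sqrt_abs abs_divide abs_numeral)
  then have "top_eigenvalue \<beta> B = (\<mu> + \<nu>) / 2 + \<bar>\<mu> - \<nu>\<bar> / 2"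
    by (simp add: top_eigenvalue_def tr)
  then show ?thesis by (auto simp: max_def field_simps)
qed

text \<open>The factor \<open>pairing_count N\<close> does not depend on \<open>B\<close>, so it cancels when partition functions at
  two different fields are compared.\<close>

lemma annealed_partition_bounds:
  assumes "\<beta> \<ge> 0" "N > 0"
  shows "top_eigenvalue \<beta> B ^ N * pairing_count N \<le> annealed_partition \<beta> B N"
    and "annealed_partition \<beta> B N \<le> 2 * real N * (real N + 1) * (top_eigenvalue \<beta> B ^ N * pairing_count N)"
proof -
  obtain u v where uv: "diagonalizing \<beta> B u v"
    by (rule diagonalizing_exists[OF assms(1)])
  show "top_eigenvalue \<beta> B ^ N * pairing_count N \<le> annealed_partition \<beta> B N"
    "annealed_partition \<beta> B N \<le> 2 * real N * (real N + 1) * (top_eigenvalue \<beta> B ^ N * pairing_count N)"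
    using annealed_partition_bounds_max[OF uv assms(2)] unfolding max_eq_top_eigenvalue[OF uv] by blast+
qed

section \<open>Large deviations of the total spin\<close>

lemma annealed_mass_nonneg: "annealed_mass (CM2 N) \<beta> B N \<sigma> \<ge> 0"
  using pairing_weight_pos annealed_partition_pos by (simp add: annealed_mass_CM2 less_imp_le)

lemma sum_annealed_mass: "(\<Sum>\<sigma>\<in>spin_configs N. annealed_mass (CM2 N) \<beta> B N \<sigma>) = 1"
  using annealed_partition_pos[of \<beta> B N]
  by (simp add: annealed_mass_CM2 flip: sum_divide_distrib annealed_partition_def)

lemma integral_annealed_measure:
  fixes f :: "(nat \<Rightarrow> real) \<Rightarrow> real"
  shows "(\<integral>\<sigma>. f \<sigma> \<partial>annealed_measure (CM2 N) \<beta> B N) =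
         (\<Sum>\<sigma>\<in>spin_configs N. annealed_mass (CM2 N) \<beta> B N \<sigma> * f \<sigma>)"
  unfolding annealed_measure_def
  by (simp add: lebesgue_integral_point_measure_finite finite_spin_configs annealed_mass_nonneg)

lemma measure_annealed_measure:
  assumes "A \<subseteq> spin_configs N"
  shows "measure (annealed_measure (CM2 N) \<beta> B N) A = (\<Sum>\<sigma>\<in>A. annealed_mass (CM2 N) \<beta> B N \<sigma>)"
  unfolding annealed_measure_def
  using assms by (subst measure_point_measure_finite_if) (auto simp: finite_spin_configs annealed_mass_nonneg)

lemma space_annealed_measure: "space (annealed_measure Q \<beta> B N) = spin_configs N"
  by (simp add: annealed_measure_def space_point_measure)

text \<open>Tilting by \<open>exp (t S)\<close> is the same as shifting the external field by \<open>t\<close>.\<close>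

lemma annealed_moment_generating_function:
  "(\<Sum>\<sigma>\<in>spin_configs N. annealed_mass (CM2 N) \<beta> B N \<sigma> * exp (t * total_spin N \<sigma>)) =
     annealed_partition \<beta> (B + t) N / annealed_partition \<beta> B N"
  unfolding annealed_partition_def[of \<beta> "B + t"] sum_divide_distrib
  by (intro sum.cong refl) (simp add: annealed_mass_CM2 distrib_right exp_add)

lemma top_eigenvalue_pos: "top_eigenvalue \<beta> B > 0"
  unfolding top_eigenvalue_def
  by (intro add_pos_nonneg mult_pos_pos) auto

abbreviation magnetization :: "real \<Rightarrow> real \<Rightarrow> real" where
  "magnetization \<beta> B \<equiv> sinh B / sqrt ((sinh B)\<^sup>2 + exp (- 4 * \<beta>))"

lemma DERIV_ln_top_eigenvalue:
  "((\<lambda>B. ln (top_eigenvalue \<beta> B)) has_real_derivative magnetization \<beta> B) (at B)"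
proof -
  define r where "r = sqrt ((exp \<beta> * sinh B)\<^sup>2 + exp (- 2 * \<beta>))"
  have arg: "(exp \<beta> * sinh B)\<^sup>2 + exp (- 2 * \<beta>) > 0"
    by (intro add_nonneg_pos) auto
  then have r: "r > 0" by (simp add: r_def)
  have deriv: "(top_eigenvalue \<beta> has_real_derivative
      exp \<beta> * sinh B + (2 * (exp \<beta> * sinh B) * (exp \<beta> * cosh B)) * (inverse r / 2)) (at B)"
    unfolding top_eigenvalue_def[abs_def] r_def using arg
    by (auto intro!: derivative_eq_intros)
  have "(top_eigenvalue \<beta> has_real_derivative exp \<beta> * sinh B * top_eigenvalue \<beta> B / r) (at B)"
  proof -
    have "top_eigenvalue \<beta> B = exp \<beta> * cosh B + r" by (simp add: top_eigenvalue_def r_def)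
    then have "exp \<beta> * sinh B + (2 * (exp \<beta> * sinh B) * (exp \<beta> * cosh B)) * (inverse r / 2) =
        exp \<beta> * sinh B * top_eigenvalue \<beta> B / r"
      using r by (simp add: field_simps)
    with deriv show ?thesis by simp
  qed
  then have "((\<lambda>B. ln (top_eigenvalue \<beta> B)) has_real_derivative
      1 / top_eigenvalue \<beta> B * (exp \<beta> * sinh B * top_eigenvalue \<beta> B / r)) (at B)"
    by (rule DERIV_chain2[where f = ln and g = "top_eigenvalue \<beta>" and x = B, OF DERIV_ln_divide[OF top_eigenvalue_pos[of \<beta> B]]])
  moreover have "1 / top_eigenvalue \<beta> B * (exp \<beta> * sinh B * top_eigenvalue \<beta> B / r) = magnetization \<beta> B"
  proof -
    have "(exp \<beta> * sinh B)\<^sup>2 + exp (- 2 * \<beta>) = (exp \<beta>)\<^sup>2 * ((sinh B)\<^sup>2 + exp (- 4 * \<beta>))"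
      by (simp add: power_mult_distrib distrib_left power2_eq_square flip: exp_add)
    then have "r = exp \<beta> * sqrt ((sinh B)\<^sup>2 + exp (- 4 * \<beta>))"
      by (simp add: r_def real_sqrt_mult)
    then show ?thesis using top_eigenvalue_pos[of \<beta> B] by simp
  qed
  ultimately show ?thesis by simp
qed

text \<open>The exponential Chebyshev inequality for \<open>s\<close> times the total spin, which covers the upper
  tail (\<open>s = 1\<close>) and the lower tail (\<open>s = -1\<close>) at once.\<close>

lemma annealed_tail_le:
  assumes "t > 0"
  shows "measure (annealed_measure (CM2 N) \<beta> B N)
           {\<sigma> \<in> spin_configs N. total_spin N \<sigma> * s \<ge> real N * x}
         \<le> exp (- (real N * x * t)) * (annealed_partition \<beta> (B + s * t) N / annealed_partition \<beta> B N)"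
proof -
  let ?A = "{\<sigma> \<in> spin_configs N. total_spin N \<sigma> * s \<ge> real N * x}"
  let ?m = "annealed_mass (CM2 N) \<beta> B N"
  have "measure (annealed_measure (CM2 N) \<beta> B N) ?A = (\<Sum>\<sigma>\<in>?A. ?m \<sigma>)"
    by (rule measure_annealed_measure) auto
  also have "\<dots> \<le> (\<Sum>\<sigma>\<in>?A. exp (- (real N * x * t)) * (?m \<sigma> * exp (s * t * total_spin N \<sigma>)))"
  proof (rule sum_mono)
    fix \<sigma> assume "\<sigma> \<in> ?A"
    then have "real N * x * t \<le> total_spin N \<sigma> * s * t"
      using assms by (intro mult_right_mono) auto
    then have "1 \<le> exp (- (real N * x * t)) * exp (s * t * total_spin N \<sigma>)"
      by (simp add: mult_ac flip: exp_add)
    then show "?m \<sigma> \<le> exp (- (real N * x * t)) * (?m \<sigma> * exp (s * t * total_spin N \<sigma>))"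
      using mult_left_mono[OF _ annealed_mass_nonneg[of N \<beta> B \<sigma>]] by (fastforce simp: mult_ac)
  qed
  also have "\<dots> \<le> (\<Sum>\<sigma>\<in>spin_configs N. exp (- (real N * x * t)) * (?m \<sigma> * exp (s * t * total_spin N \<sigma>)))"
    by (intro sum_mono2 finite_spin_configs) (auto simp: annealed_mass_nonneg)
  also have "\<dots> = exp (- (real N * x * t)) * (annealed_partition \<beta> (B + s * t) N / annealed_partition \<beta> B N)"
    by (simp only: annealed_moment_generating_function flip: sum_distrib_left)
  finally show ?thesis .
qed

text \<open>Up to polynomial factors the Chernoff bound is \<open>exp (N (f t - f 0))\<close> with \<open>f\<close> as in the proof, and
  \<open>f\<close> has derivative \<open>-\<epsilon>\<close> at \<open>0\<close> because the magnetization is the derivative of the pressure.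
  Hence some small \<open>t > 0\<close> gives exponential decay.\<close>

lemma annealed_tail_exponential:
  assumes "\<beta> \<ge> 0" "\<epsilon> > 0"
  shows "\<exists>\<delta>>0. \<forall>N>0. measure (annealed_measure (CM2 N) \<beta> B N)
           {\<sigma> \<in> spin_configs N. total_spin N \<sigma> * s \<ge> real N * (magnetization \<beta> B * s + \<epsilon>)}
         \<le> 2 * real N * (real N + 1) * exp (- (real N * \<delta>))"
proof -
  let ?x = "magnetization \<beta> B * s + \<epsilon>"
  define f where "f t = ln (top_eigenvalue \<beta> (B + s * t)) - ?x * t" for t
  have "(f has_real_derivative magnetization \<beta> (B + s * 0) * s - ?x) (at 0)"
    unfolding f_def[abs_def]
    by (rule derivative_eq_intros DERIV_chain2[OF DERIV_ln_top_eigenvalue] refl | simp)+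
  then obtain d where d: "d > 0" "\<And>h. h > 0 \<Longrightarrow> h < d \<Longrightarrow> f (0 + h) < f 0"
    using DERIV_neg_dec_right[of f _ 0] assms by fastforce
  define t where "t = d / 2"
  have t: "t > 0" "f t < f 0" using d by (auto simp: t_def)
  show ?thesis
  proof (intro exI[of _ "f 0 - f t"] conjI allI impI)
    show "f 0 - f t > 0" using t by simp
    fix N :: nat assume N: "N > 0"
    let ?l = "top_eigenvalue \<beta>"
    have "annealed_partition \<beta> (B + s * t) N / annealed_partition \<beta> B N \<le>
       (2 * real N * (real N + 1) * (?l (B + s * t) ^ N * pairing_count N)) / (?l B ^ N * pairing_count N)"
      using annealed_partition_bounds[OF assms(1) N] top_eigenvalue_pos[of \<beta>] pairing_count_pos[of N] annealed_partition_pos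
      by (intro frac_le) (auto simp: less_imp_le)
    also have "\<dots> = 2 * real N * (real N + 1) * (?l (B + s * t) / ?l B) ^ N"
      using pairing_count_pos[of N] by (simp add: power_divide)
    also have "?l (B + s * t) / ?l B = exp (ln (?l (B + s * t)) - ln (?l B))"
      using top_eigenvalue_pos[of \<beta>] by (simp add: exp_diff)
    also have "\<dots> ^ N = exp (real N * (ln (?l (B + s * t)) - ln (?l B)))"
      by (simp add: exp_of_nat_mult)
    finally have ratio: "annealed_partition \<beta> (B + s * t) N / annealed_partition \<beta> B N \<le>
        2 * real N * (real N + 1) * exp (real N * (ln (?l (B + s * t)) - ln (?l B)))" .
    have "measure (annealed_measure (CM2 N) \<beta> B N) {\<sigma> \<in> spin_configs N. total_spin N \<sigma> * s \<ge> real N * ?x}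
         \<le> exp (- (real N * ?x * t)) * (annealed_partition \<beta> (B + s * t) N / annealed_partition \<beta> B N)"
      by (rule annealed_tail_le[OF t(1)])
    also have "\<dots> \<le> exp (- (real N * ?x * t)) *
        (2 * real N * (real N + 1) * exp (real N * (ln (?l (B + s * t)) - ln (?l B))))"
      by (rule mult_left_mono[OF ratio]) simp
    also have "\<dots> = 2 * real N * (real N + 1) *
        (exp (- (real N * ?x * t)) * exp (real N * (ln (?l (B + s * t)) - ln (?l B))))"
      by (simp only: mult_ac)
    also have "exp (- (real N * ?x * t)) * exp (real N * (ln (?l (B + s * t)) - ln (?l B))) =
        exp (- (real N * (f 0 - f t)))"
      unfolding exp_add[symmetric] f_def by (simp add: algebra_simps)
    finally show "measure (annealed_measure (CM2 N) \<beta> B N)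
          {\<sigma> \<in> spin_configs N. total_spin N \<sigma> * s \<ge> real N * ?x}
         \<le> 2 * real N * (real N + 1) * exp (- (real N * (f 0 - f t)))" .
  qed
qed

text \<open>Half of the exponential rate absorbs the polynomial factor and the two tails.\<close>

lemma annealed_concentration:
  assumes "\<beta> \<ge> 0" "\<epsilon> > 0"
  shows "\<exists>L>0. \<forall>\<^sub>F N in sequentially.
           measure (annealed_measure (CM2 N) \<beta> B N)
             {\<sigma> \<in> spin_configs N. \<bar>total_spin N \<sigma> / real N - magnetization \<beta> B\<bar> \<ge> \<epsilon>}
           \<le> exp (- (real N * L))"
proof -
  let ?m = "magnetization \<beta> B"
  let ?P = "\<lambda>N. measure (annealed_measure (CM2 N) \<beta> B N)"
  let ?U = "\<lambda>N s. {\<sigma> \<in> spin_configs N. total_spin N \<sigma> * s \<ge> real N * (?m * s + \<epsilon>)}"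
  obtain \<delta>1 where \<delta>1: "\<delta>1 > 0"
    "\<forall>N>0. ?P N (?U N 1) \<le> 2 * real N * (real N + 1) * exp (- (real N * \<delta>1))"
    using annealed_tail_exponential[OF assms, of B 1] by blast
  obtain \<delta>2 where \<delta>2: "\<delta>2 > 0"
    "\<forall>N>0. ?P N (?U N (-1)) \<le> 2 * real N * (real N + 1) * exp (- (real N * \<delta>2))"
    using annealed_tail_exponential[OF assms, of B "-1"] by blast
  define \<delta> where "\<delta> = min \<delta>1 \<delta>2"
  have \<delta>: "\<delta> > 0" using \<delta>1 \<delta>2 by (simp add: \<delta>_def)
  have "((\<lambda>N. 4 * real N * (real N + 1) * exp (- (real N * (\<delta> / 2)))) \<longlonglongrightarrow> 0)"
    using \<delta> by real_asymp
  then have "\<forall>\<^sub>F N in sequentially. 4 * real N * (real N + 1) * exp (- (real N * (\<delta> / 2))) < 1"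
    by (rule order_tendstoD) simp
  then have "\<forall>\<^sub>F N in sequentially. ?P N {\<sigma> \<in> spin_configs N. \<bar>total_spin N \<sigma> / real N - ?m\<bar> \<ge> \<epsilon>}
           \<le> exp (- (real N * (\<delta> / 2)))"
    using eventually_gt_at_top[of 0]
  proof eventually_elim
    case (elim N)
    interpret prob_space "annealed_measure (CM2 N) \<beta> B N" by (rule prob_space_annealed_CM2)
    have sets: "A \<in> events" if "A \<subseteq> spin_configs N" for A
      using that by (simp add: annealed_measure_def sets_point_measure)
    have "{\<sigma> \<in> spin_configs N. \<bar>total_spin N \<sigma> / real N - ?m\<bar> \<ge> \<epsilon>} \<subseteq> ?U N 1 \<union> ?U N (-1)"
    proof
      fix \<sigma> assume \<sigma>: "\<sigma> \<in> {\<sigma> \<in> spin_configs N. \<bar>total_spin N \<sigma> / real N - ?m\<bar> \<ge> \<epsilon>}"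
      define x where "x = total_spin N \<sigma> / real N"
      have x: "total_spin N \<sigma> = real N * x" using elim by (simp add: x_def)
      from \<sigma> have "x \<ge> ?m + \<epsilon> \<or> - x \<ge> - ?m + \<epsilon>" by (auto simp: x_def)
      then have "real N * x \<ge> real N * (?m + \<epsilon>) \<or> real N * (- x) \<ge> real N * (- ?m + \<epsilon>)"
        using mult_left_mono[of _ _ "real N"] by (meson of_nat_0_le_iff)
      then show "\<sigma> \<in> ?U N 1 \<union> ?U N (-1)" using \<sigma> x by simp
    qed
    then have "?P N {\<sigma> \<in> spin_configs N. \<bar>total_spin N \<sigma> / real N - ?m\<bar> \<ge> \<epsilon>} \<le> ?P N (?U N 1 \<union> ?U N (-1))"
      by (intro finite_measure_mono sets) auto
    also have "\<dots> \<le> ?P N (?U N 1) + ?P N (?U N (-1))"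
      by (intro measure_Un_le sets) auto
    also have "\<dots> \<le> 2 * real N * (real N + 1) * exp (- (real N * \<delta>)) + 2 * real N * (real N + 1) * exp (- (real N * \<delta>))"
    proof (intro add_mono)
      have "2 * real N * (real N + 1) * exp (- (real N * \<delta>')) \<le> 2 * real N * (real N + 1) * exp (- (real N * \<delta>))"
        if "\<delta> \<le> \<delta>'" for \<delta>'
        using that by (intro mult_left_mono) (auto intro: mult_left_mono)
      then have mono: "2 * real N * (real N + 1) * exp (- (real N * \<delta>1)) \<le> 2 * real N * (real N + 1) * exp (- (real N * \<delta>))"
        "2 * real N * (real N + 1) * exp (- (real N * \<delta>2)) \<le> 2 * real N * (real N + 1) * exp (- (real N * \<delta>))"
        by (simp_all add: \<delta>_def)
      show "?P N (?U N 1) \<le> 2 * real N * (real N + 1) * exp (- (real N * \<delta>))"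
        by (rule order_trans[OF _ mono(1)]) (use \<delta>1(2) elim in blast)
      show "?P N (?U N (-1)) \<le> 2 * real N * (real N + 1) * exp (- (real N * \<delta>))"
        by (rule order_trans[OF _ mono(2)]) (use \<delta>2(2) elim in blast)
    qed
    also have "\<dots> = 4 * real N * (real N + 1) * exp (- (real N * (\<delta> / 2))) * exp (- (real N * (\<delta> / 2)))"
      by (simp add: mult.assoc flip: exp_add)
    also have "\<dots> \<le> 1 * exp (- (real N * (\<delta> / 2)))"
      using elim by (intro mult_right_mono) auto
    finally show ?case by simp
  qed
  then show ?thesis using \<delta> by (intro exI[of _ "\<delta> / 2"]) auto
qed

lemma abs_total_spin_le:
  assumes "\<sigma> \<in> spin_configs N"
  shows "\<bar>total_spin N \<sigma> / real N\<bar> \<le> 1"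
proof -
  have "\<bar>\<sigma> i\<bar> = 1" if "i \<in> {1..N}" for i
    using PiE_mem[OF assms[unfolded spin_configs_def] that] by auto
  then have "\<bar>total_spin N \<sigma>\<bar> \<le> (\<Sum>i\<in>{1..N}. 1)"
    unfolding total_spin_def by (intro order_trans[OF sum_abs] sum_mono) auto
  then show ?thesis by (cases "N = 0") (auto simp: field_simps)
qed

text \<open>Since \<open>S / N\<close> is bounded by \<open>1\<close>, concentration implies convergence of the mean: the event of an
  \<open>e / 2\<close>-deviation contributes at most \<open>1 + \<bar>m\<bar>\<close> times its exponentially small probability, where
  \<open>m\<close> is the magnetization.\<close>

lemma annealed_mean_spin_tendsto:
  assumes "\<beta> \<ge> 0"
  shows "annealed_mean_spin \<beta> B \<longlonglongrightarrow> magnetization \<beta> B"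
proof (rule LIMSEQ_I)
  let ?m = "magnetization \<beta> B"
  let ?w = "\<lambda>N. annealed_mass (CM2 N) \<beta> B N"
  fix e :: real assume e: "e > 0"
  let ?A = "\<lambda>N. {\<sigma> \<in> spin_configs N. \<bar>total_spin N \<sigma> / real N - ?m\<bar> \<ge> e / 2}"
  have bound: "\<bar>annealed_mean_spin \<beta> B N - ?m\<bar> \<le>
      e / 2 + (1 + \<bar>?m\<bar>) * measure (annealed_measure (CM2 N) \<beta> B N) (?A N)" for N
  proof -
    have "annealed_mean_spin \<beta> B N - ?m =
        (\<Sum>\<sigma>\<in>spin_configs N. ?w N \<sigma> * (total_spin N \<sigma> / real N)) - (\<Sum>\<sigma>\<in>spin_configs N. ?w N \<sigma>) * ?m"
      by (simp only: annealed_mean_spin_def integral_annealed_measure sum_annealed_mass mult_1)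
    also have "\<dots> = (\<Sum>\<sigma>\<in>spin_configs N. ?w N \<sigma> * (total_spin N \<sigma> / real N - ?m))"
      by (simp only: right_diff_distrib sum_subtractf sum_distrib_right)
    finally have diff: "annealed_mean_spin \<beta> B N - ?m =
        (\<Sum>\<sigma>\<in>spin_configs N. ?w N \<sigma> * (total_spin N \<sigma> / real N - ?m))" .
    have "\<bar>annealed_mean_spin \<beta> B N - ?m\<bar> \<le>
        (\<Sum>\<sigma>\<in>spin_configs N. ?w N \<sigma> * (e / 2 + (if \<sigma> \<in> ?A N then 1 + \<bar>?m\<bar> else 0)))"
      unfolding diff
    proof (intro order_trans[OF sum_abs] sum_mono)
      fix \<sigma> assume \<sigma>: "\<sigma> \<in> spin_configs N"
      have "\<bar>total_spin N \<sigma> / real N - ?m\<bar> \<le> e / 2 + (if \<sigma> \<in> ?A N then 1 + \<bar>?m\<bar> else 0)"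
        using abs_total_spin_le[OF \<sigma>] abs_triangle_ineq4[of "total_spin N \<sigma> / real N" ?m] \<sigma> e
        by (cases "\<sigma> \<in> ?A N") auto
      then show "\<bar>?w N \<sigma> * (total_spin N \<sigma> / real N - ?m)\<bar> \<le>
          ?w N \<sigma> * (e / 2 + (if \<sigma> \<in> ?A N then 1 + \<bar>?m\<bar> else 0))"
        unfolding abs_mult by (intro mult_mono) (auto simp: annealed_mass_nonneg)
    qed
    also have "\<dots> = e / 2 * (\<Sum>\<sigma>\<in>spin_configs N. ?w N \<sigma>) + (1 + \<bar>?m\<bar>) * (\<Sum>\<sigma>\<in>?A N. ?w N \<sigma>)"
    proof -
      have "(\<Sum>\<sigma>\<in>spin_configs N. ?w N \<sigma> * (if \<sigma> \<in> ?A N then 1 + \<bar>?m\<bar> else 0)) =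
          (\<Sum>\<sigma>\<in>?A N. ?w N \<sigma> * (1 + \<bar>?m\<bar>))"
        by (intro sum.mono_neutral_cong_right finite_spin_configs) auto
      also have "\<dots> = (1 + \<bar>?m\<bar>) * (\<Sum>\<sigma>\<in>?A N. ?w N \<sigma>)"
        by (subst sum_distrib_right[symmetric]) (rule mult.commute)
      moreover have "(\<Sum>\<sigma>\<in>spin_configs N. ?w N \<sigma> * (e / 2)) = e / 2 * (\<Sum>\<sigma>\<in>spin_configs N. ?w N \<sigma>)"
        by (subst sum_distrib_right[symmetric]) (rule mult.commute)
      ultimately show ?thesis
        by (simp only: distrib_left sum.distrib)
    qed
    finally show ?thesis
      by (simp add: sum_annealed_mass measure_annealed_measure)
  qed
  obtain L where L: "L > 0" and ev: "\<forall>\<^sub>F N in sequentially.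
      measure (annealed_measure (CM2 N) \<beta> B N) (?A N) \<le> exp (- (real N * L))"
    using annealed_concentration[OF assms, of "e / 2" B] e by auto
  have "(\<lambda>N. (1 + \<bar>?m\<bar>) * exp (- (real N * L))) \<longlonglongrightarrow> (1 + \<bar>?m\<bar>) * 0"
    by (intro tendsto_mult tendsto_const) (use L in real_asymp)
  then have "\<forall>\<^sub>F N in sequentially. (1 + \<bar>?m\<bar>) * exp (- (real N * L)) < e / 2"
    by (rule order_tendstoD) (use e in simp)
  with ev have "\<forall>\<^sub>F N in sequentially. norm (annealed_mean_spin \<beta> B N - ?m) < e"
  proof eventually_elim
    case (elim N)
    have "(1 + \<bar>?m\<bar>) * measure (annealed_measure (CM2 N) \<beta> B N) (?A N) \<le> (1 + \<bar>?m\<bar>) * exp (- (real N * L))"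
      by (rule mult_left_mono[OF elim(1)]) simp
    with elim(2) bound[of N] show ?case unfolding real_norm_def by linarith
  qed
  then show "\<exists>no. \<forall>n\<ge>no. norm (annealed_mean_spin \<beta> B n - ?m) < e"
    by (simp only: eventually_sequentially)
qed

theorem theorem1p5:
  fixes \<beta> B :: real
  assumes "\<beta> \<ge> 0"
  shows "annealed_mean_spin \<beta> B \<longlonglongrightarrow> annealed_magnetization \<beta> B \<and>
         annealed_magnetization \<beta> B = sinh B / sqrt ((sinh B)\<^sup>2 + exp (- 4 * \<beta>)) \<and>
         (\<forall>\<epsilon>::real. \<epsilon> > 0 \<longrightarrow> (\<exists>L::real. L > 0 \<and> (\<forall>\<^sub>F N in sequentially.
           measure (annealed_measure (CM2 N) \<beta> B N)
             {\<sigma> \<in> space (annealed_measure (CM2 N) \<beta> B N).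
                \<bar>total_spin N \<sigma> / real N - annealed_magnetization \<beta> B\<bar> \<ge> \<epsilon>}
           \<le> exp (- (real N * L)))))"
proof -
  have "annealed_magnetization \<beta> B = magnetization \<beta> B"
    unfolding annealed_magnetization_def by (rule limI[OF annealed_mean_spin_tendsto[OF assms]])
  then show ?thesis
    using annealed_mean_spin_tendsto[OF assms] annealed_concentration[OF assms]
    by (simp only: space_annealed_measure) blast
qed

end
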